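(* Let $a,c>0$ and $b,d\in\mathbb{R}$, and let $h(y)=(\alpha y+\beta)^t$ with $\alpha,\beta,t\in\mathbb{R}$. For $r\geq 0$ set $$\Delta(r):=\sqrt{\sqrt{a}\,r\,\frac{\sqrt{ar^2+4}+r\sqrt{a}}{2}}-\frac{\pi r}{c}.$$ Let $r_0\geq 0$ be a point at which $\Delta(r)$ attains its maximum over $r\ge 0$, and put $w=\min(1,\Delta(r_0))$. Then, as $x\to\infty$, $$\sum_{n\in\mathbb{Z}:\ an^2+bn+d<x}(-1)^n e^{c\sqrt{x-(an^2+bn+d)}}\,h(n)\ \ll\ \sqrt{x}\,e^{wc\sqrt{x}}.$$
   Context: The implied constant may depend on $a,b,c,d,\alpha,\beta,t$. The square root is the nonnegative real square root (its argument is positive in the range of summation).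
   Formalization: The formal theorem assumes (αy+β)^t is defined as a real power for every real y, so α=0 or t is a nonnegative integer; otherwise h(n) can be undefined, or the claim fails, e.g. a=c=1, b=d=0, h(y)=(y+1/2)^(-1), where the sum is ~ π e^{√x}. *)

theory Defs
  imports Complex_Main "HOL-Library.Landau_Symbols"
begin

text \<open>
  Real powers \<open>x\<^sup>t\<close> with a possibly non-positive base. The library's real \<open>powr\<close> does not
  give the usual integer powers of negative numbers, and it has \<open>0 powr 0 = 0\<close>. Here integer
  exponents mean ordinary integer powers (so \<open>0\<^sup>0 = 1\<close>); for \<open>x > 0\<close> this agrees with \<open>powr\<close>.
  The value is meaningful exactly where \<open>real_power_defined\<close> holds.
\<close>

definition real_power :: "real \<Rightarrow> real \<Rightarrow> real" where
  "real_power x t = (if t \<in> \<int> then x powi \<lfloor>t\<rfloor> else x powr t)"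

definition real_power_defined :: "real \<Rightarrow> real \<Rightarrow> bool" where
  "real_power_defined x t \<longleftrightarrow> x > 0 \<or> (x = 0 \<and> t \<ge> 0) \<or> (x < 0 \<and> t \<in> \<int>)"

definition Delta :: "real \<Rightarrow> real \<Rightarrow> real \<Rightarrow> real" where
  "Delta a c r =
     sqrt (sqrt a * r * ((sqrt (a * r\<^sup>2 + 4) + r * sqrt a) / 2)) - pi * r / c"

end

(* A point r0 where Delta is maximal exists only if c * sqrt a <= pi, and then Delta a c r0 > 0; so
   it suffices to bound the sum by a power of x. For 0 < s the error in exp s = 2 cosh s - exp (-s)
   is at most 1, and f(z) = cosh (c sqrt (x - (a z^2 + b z + d))) is entire and bounded by 1 at the
   integers outside the range of summation. So the sum may be replaced by the sum of (-1)^n f(n) h(n)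
   over |n| <= M, with M a large multiple of x. This is the integral of f(z) h(z) / (2 i sin (pi z))
   over the square with half side M + 1/2, on which |f(z)| is at most a constant times
   exp (c sqrt a |Im z|), hence is dominated by |sin (pi z)|.
   The hypothesis that h is defined on all of R forces h to be a constant or a power of
   alpha y + beta with exponent in N. *)
theory Submission
  imports Defs "HOL-Complex_Analysis.Residue_Theorem" "HOL-Real_Asymp.Real_Asymp"
begin

section \<open>The entire function cosh (c sqrt w)\<close>

text \<open>Both \<open>csqrt (- w)\<close> and \<open>\<i> * csqrt w\<close> are square roots of
  \<open>- w\<close>, so they agree up to sign, and cosh is even. This gives a second formula for
  the same function, with the branch cut on the opposite half-line.\<close>

lemma cosh_csqrt_uminus: "cosh (c * csqrt (- w)) = cosh (c * (\<i> * csqrt w))"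
proof -
  have "(csqrt (- w))\<^sup>2 = (\<i> * csqrt w)\<^sup>2"
    by (simp add: power_mult_distrib)
  then have "csqrt (- w) = \<i> * csqrt w \<or> csqrt (- w) = - (\<i> * csqrt w)"
    by (rule power2_eq_iff[THEN iffD1])
  then show ?thesis
    by (metis cosh_minus mult_minus_right)
qed

text \<open>The two formulas for the function are holomorphic on the plane slit along the
  nonpositive and along the nonnegative reals. The slit planes cover everything but 0, and the
  singularity at 0 is removable by continuity.\<close>

lemma holomorphic_cosh_csqrt: "(\<lambda>w. cosh (c * csqrt w)) holomorphic_on UNIV"
proof -
  let ?F = "\<lambda>w. cosh (c * csqrt w)"
  have 1: "?F holomorphic_on (- \<real>\<^sub>\<le>\<^sub>0)"
    unfolding cosh_def by (intro holomorphic_intros) auto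
  have "(\<lambda>w. cosh (c * (\<i> * csqrt (- w)))) holomorphic_on (- \<real>\<^sub>\<ge>\<^sub>0)"
    unfolding cosh_def by (intro holomorphic_intros) (auto simp: uminus_nonneg_Reals_iff complex_nonneg_Reals_iff complex_nonpos_Reals_iff)
  then have 2: "?F holomorphic_on (- \<real>\<^sub>\<ge>\<^sub>0)"
    by (metis (no_types, lifting) cosh_csqrt_uminus holomorphic_cong minus_minus)
  have "- \<real>\<^sub>\<le>\<^sub>0 \<union> - \<real>\<^sub>\<ge>\<^sub>0 = UNIV - {0::complex}"
    by (auto simp: complex_nonneg_Reals_iff complex_nonpos_Reals_iff complex_eq_iff)
  then have 3: "?F holomorphic_on UNIV - {0}"
    by (metis 1 2 holomorphic_on_Un open_Compl closed_nonneg_Reals_complex closed_nonpos_Reals_complex)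
  \<comment> \<open>Although \<open>csqrt\<close> jumps across its cut, its norm is the real square
    root of the norm of the argument, which tends to 0 at 0.\<close>
  have "(csqrt \<longlongrightarrow> 0) (at 0)"
    by (rule tendsto_norm_zero_cancel) (auto intro!: tendsto_eq_intros)
  then have 4: "(?F \<longlongrightarrow> ?F 0) (at 0)"
    unfolding cosh_def by (auto intro!: tendsto_eq_intros)
  show ?thesis
    by (rule no_isolated_singularity'[where K = "{0}"]) (use 3 4 in auto)
qed

section \<open>Alternating sums as contour integrals over squares\<close>

text \<open>With y = pi Im z, the squared norm of sin (pi z) is (cosh (2 y) - cos (2 pi Re z)) / 2.
  On the vertical sides the cosine equals -1; on the horizontal sides cosh is large enough to absorb
  it.\<close>

lemma norm_sin_pi_ge_on_square:
  fixes M :: nat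
  assumes "\<bar>Re z\<bar> = real M + 1/2 \<or> \<bar>Im z\<bar> = real M + 1/2"
  shows "exp (pi * \<bar>Im z\<bar>) / 4 \<le> norm (sin (complex_of_real pi * z))"
proof -
  define y where "y = pi * Im z"
  define E T where "E = exp (2 * \<bar>y\<bar>)" and "T = exp (2 * y) + inverse (exp (2 * y))"
  have "E > 0"
    by (simp add: E_def)
  have ay: "\<bar>y\<bar> = pi * \<bar>Im z\<bar>"
    by (simp add: y_def abs_mult)
  have E_le: "E \<le> T"
    by (cases "y \<ge> 0") (auto simp: E_def T_def exp_minus)
  have sq: "(norm (sin (complex_of_real pi * z)))\<^sup>2
      = (T - 2 * cos (2 * (pi * Re z))) / 4"
    by (subst norm_sin_squared) (simp add: y_def T_def)
  have "E / 16 \<le> (norm (sin (complex_of_real pi * z)))\<^sup>2"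
    using assms
  proof
    assume *: "\<bar>Re z\<bar> = real M + 1/2"
    \<comment> \<open>The half side is a half-integer, so the argument is an odd multiple of pi up
      to sign.\<close>
    have "cos (2 * (pi * Re z)) = cos \<bar>2 * (pi * Re z)\<bar>"
      by simp
    also have "\<bar>2 * (pi * Re z)\<bar> = pi + 2 * real M * pi"
      using * by (simp add: abs_mult algebra_simps)
    also have "cos \<dots> = -1"
      by (simp only: cos_add cos_2npi sin_2npi) simp
    finally show ?thesis
      using E_le \<open>E > 0\<close> unfolding sq by simp
  next
    assume *: "\<bar>Im z\<bar> = real M + 1/2"
    \<comment> \<open>This holds even for M = 0, since the half side is at least 1/2 and pi > 3. It
      yields E >= 4, enough for E - 2 >= E / 4.\<close>
    have "3/2 \<le> \<bar>y\<bar>"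
      using * pi_gt3 mult_mono[of 3 pi "1/2" "\<bar>Im z\<bar>"] by (simp add: ay)
    then have "4 \<le> E"
      unfolding E_def using exp_ge_add_one_self[of "2 * \<bar>y\<bar>"] by linarith
    then have "E / 16 \<le> (T - 2 * 1) / 4"
      using E_le by simp
    also have "\<dots> \<le> (T - 2 * cos (2 * (pi * Re z))) / 4"
      by (intro divide_right_mono diff_left_mono mult_left_mono) auto
    finally show ?thesis
      unfolding sq .
  qed
  moreover have "(exp (pi * \<bar>Im z\<bar>) / 4)\<^sup>2 = E / 16"
    by (simp add: E_def ay power_divide flip: exp_double)
  ultimately show ?thesis
    by (metis norm_ge_zero power2_le_imp_le)
qed

text \<open>The derivative of sin (pi z) at an integer n is pi (-1)^n, so the residue of the
  integrand there is (-1)^n f(n) / pi; the factor 2 pi i of the residue theorem then becomes 2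
  i.\<close>

lemma alternating_sum_eq_contour_integral:
  fixes M :: nat and f :: "complex \<Rightarrow> complex"
  defines "R \<equiv> real M + 1/2"
  assumes f: "f holomorphic_on UNIV"
  shows "contour_integral (rectpath (Complex (-R) (-R)) (Complex R R)) (\<lambda>z. f z / sin (pi * z))
       = 2 * \<i> * (\<Sum>n\<in>{- int M..int M}. (-1) powi n * f (of_int n))"
proof -
  \<comment> \<open>The open strip contains the closed square but no integer beyond M in absolute
    value, so only finitely many singularities lie in it.\<close>
  define S where "S = {z. - (real M + 1) < Re z} \<inter> {z. Re z < real M + 1}"
  define P where "P = (of_int ` {- int M..int M} :: complex set)"
  define \<gamma> where "\<gamma> = rectpath (Complex (-R) (-R)) (Complex R R)"
  let ?g = "\<lambda>z. f z / sin (complex_of_real pi * z)"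
  have "R > 0"
    by (simp add: R_def)
  have int_abs: "\<bar>n\<bar> \<le> int M" if "real_of_int \<bar>n\<bar> < real M + 1" for n
    using that by linarith
  have S: "open S" "connected S"
    by (auto simp: S_def intro!: open_halfspace_Re_lt open_halfspace_Re_gt convex_connected
          convex_Int convex_halfspace_Re_lt convex_halfspace_Re_gt)
  have sin0: "z \<in> P" if z: "z \<in> S" "sin (complex_of_real pi * z) = 0" for z
  proof -
    obtain n :: int where "complex_of_real pi * z = complex_of_real (real_of_int n * pi)"
      using z(2) by (auto simp: sin_eq_0)
    then have n: "z = of_int n"
      by simp
    with z(1) have "\<bar>n\<bar> \<le> int M"
      by (intro int_abs) (auto simp: S_def)
    with n show ?thesis
      unfolding P_def by (intro image_eqI[of _ _ n]) auto
  qed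
  have hol: "?g holomorphic_on S - P"
    using sin0 by (intro holomorphic_intros holomorphic_on_subset[OF f]) auto
  have sub: "cbox (Complex (-R) (-R)) (Complex R R) \<subseteq> S"
    by (auto simp: S_def in_cbox_complex_iff R_def)
  have P_box: "P \<subseteq> box (Complex (-R) (-R)) (Complex R R)"
    by (auto simp: P_def in_box_complex_iff R_def)
  have img: "path_image \<gamma> = cbox (Complex (-R) (-R)) (Complex R R) - box (Complex (-R) (-R)) (Complex R R)"
    unfolding \<gamma>_def by (rule path_image_rectpath_cbox_minus_box) (use \<open>R > 0\<close> in auto)
  have "contour_integral \<gamma> ?g = 2 * pi * \<i> * (\<Sum>p\<in>P. winding_number \<gamma> p * residue ?g p)"
  proof (rule Residue_theorem[OF S _ hol])
    show "\<forall>z. z \<notin> S \<longrightarrow> winding_number \<gamma> z = 0"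
      using sub \<open>R > 0\<close> unfolding \<gamma>_def by (intro allI impI winding_number_rectpath_outside) auto
  qed (use sub P_box img in \<open>auto simp: P_def \<gamma>_def\<close>)
  also have "(\<Sum>p\<in>P. winding_number \<gamma> p * residue ?g p) = (\<Sum>p\<in>P. residue ?g p)"
    using P_box by (intro sum.cong refl) (auto simp: \<gamma>_def winding_number_rectpath)
  also have "\<dots> = (\<Sum>n\<in>{- int M..int M}. residue ?g (of_int n))"
    unfolding P_def by (subst sum.reindex) (auto simp: inj_on_def)
  also have "\<dots> = (\<Sum>n\<in>{- int M..int M}. (-1) powi n * f (of_int n) / pi)"
  proof (rule sum.cong[OF refl])
    fix n :: int
    have c: "cos (complex_of_real pi * of_int n) = (-1) powi n"
    proof -
      have "cos (complex_of_real pi * of_int n) = of_real (cos (pi * real_of_int n))"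
        by (metis cos_of_real of_real_mult of_real_of_int_eq)
      also have "cos (pi * real_of_int n) = (-1) powi n"
        by (cases "even n") (auto elim!: evenE oddE simp: cos_add distrib_left mult.left_commute[of pi]
            intro: cos_int_2pin)
      finally show ?thesis
        by (simp add: of_real_power_int)
    qed
    have s: "sin (complex_of_real pi * of_int n) = 0"
      by (auto simp: sin_eq_0 intro!: exI[of _ n])
    have "((\<lambda>z. sin (complex_of_real pi * z)) has_field_derivative
        complex_of_real pi * cos (complex_of_real pi * of_int n)) (at (of_int n))"
      by (auto intro!: derivative_eq_intros)
    \<comment> \<open>The difference quotient of sin (pi z) at its zero n is this quotient, so its
      limit is the derivative.\<close>
    then have D: "((\<lambda>z. sin (complex_of_real pi * z) / (z - of_int n)) \<longlongrightarrow>
        complex_of_real pi * (-1) powi n) (at (of_int n))"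
      unfolding has_field_derivative_iff s c by simp
    have "residue ?g (of_int n) = f (of_int n) / (complex_of_real pi * (-1) powi n)"
    proof (rule residue_simple'[of "ball (of_int n) 1"])
      have "sin (complex_of_real pi * z) \<noteq> 0" if z: "z \<in> ball (of_int n) 1 - {of_int n}" for z
      proof
        assume "sin (complex_of_real pi * z) = 0"
        then obtain m :: int where "complex_of_real pi * z = complex_of_real (real_of_int m * pi)"
          by (auto simp: sin_eq_0)
        then have m: "z = of_int m"
          by simp
        have "dist (of_int n) z = \<bar>real_of_int (n - m)\<bar>"
          unfolding m dist_norm by (metis norm_of_int of_int_diff)
        with z m show False
          by auto
      qed
      then show "?g holomorphic_on ball (of_int n) 1 - {of_int n}"
        by (intro holomorphic_intros holomorphic_on_subset[OF f]) auto
      have "(f \<longlongrightarrow> f (of_int n)) (at (of_int n))"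
        using f by (metis UNIV_I continuous_on_eq_continuous_at holomorphic_on_imp_continuous_on
            isCont_def open_UNIV)
      from tendsto_divide[OF this D]
      show "((\<lambda>z. ?g z * (z - of_int n)) \<longlongrightarrow> f (of_int n) / (complex_of_real pi * (-1) powi n)) (at (of_int n))"
        by simp
    qed auto
    also have "\<dots> = (-1) powi n * f (of_int n) / pi"
      by (cases "even n") (auto simp: power_int_minus_one_mult_self)
    finally show "residue ?g (of_int n) = (-1) powi n * f (of_int n) / pi" .
  qed
  finally show ?thesis
    unfolding \<gamma>_def by (simp add: sum_divide_distrib[symmetric])
qed

text \<open>On the boundary the integrand is at most 4 B, as the exponential factors cancel. The
  perimeter is 8 R with R = M + 1/2, so the integral is at most 32 B R; division by the norm of 2 i
  leaves 16 B R.\<close>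

lemma norm_alternating_sum_le:
  fixes M :: nat and f :: "complex \<Rightarrow> complex"
  assumes f: "f holomorphic_on UNIV"
    and bound: "\<And>z. \<bar>Re z\<bar> \<le> real M + 1/2 \<Longrightarrow> \<bar>Im z\<bar> \<le> real M + 1/2 \<Longrightarrow>
      \<bar>Re z\<bar> = real M + 1/2 \<or> \<bar>Im z\<bar> = real M + 1/2 \<Longrightarrow> norm (f z) \<le> B * exp (pi * \<bar>Im z\<bar>)"
  shows "norm (\<Sum>n\<in>{- int M..int M}. (-1) powi n * f (of_int n)) \<le> 8 * B * (2 * real M + 1)"
proof -
  define R where "R = real M + 1/2"
  let ?g = "\<lambda>z. f z / sin (complex_of_real pi * z)"
  have "R > 0"
    by (simp add: R_def)
  \<comment> \<open>At the real boundary point R the exponential factor is 1, so B bounds a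
    norm.\<close>
  have "0 \<le> B"
    using order_trans[OF norm_ge_zero bound[of "of_real R"]] by (simp add: R_def)
  have g: "norm (?g z) \<le> 4 * B" and nz: "sin (complex_of_real pi * z) \<noteq> 0"
    if "\<bar>Re z\<bar> \<le> R" "\<bar>Im z\<bar> \<le> R" "\<bar>Re z\<bar> = R \<or> \<bar>Im z\<bar> = R" for z
  proof -
    have s: "exp (pi * \<bar>Im z\<bar>) / 4 \<le> norm (sin (complex_of_real pi * z))"
      using that by (intro norm_sin_pi_ge_on_square) (auto simp: R_def)
    then show "sin (complex_of_real pi * z) \<noteq> 0"
      by (auto simp: not_le)
    have "norm (?g z) \<le> (B * exp (pi * \<bar>Im z\<bar>)) / (exp (pi * \<bar>Im z\<bar>) / 4)"
      unfolding norm_divide using s bound[of z] that \<open>0 \<le> B\<close>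
      by (intro frac_le) (auto simp: R_def)
    then show "norm (?g z) \<le> 4 * B"
      by simp
  qed
  define a1 a2 a3 a4 where "a1 = Complex (-R) (-R)" and "a2 = Complex R (-R)"
    and "a3 = Complex R R" and "a4 = Complex (-R) R"
  have side: "?g contour_integrable_on linepath u v \<and>
      norm (contour_integral (linepath u v) ?g) \<le> 4 * B * (2 * R)"
    if "\<And>z. z \<in> closed_segment u v \<Longrightarrow> \<bar>Re z\<bar> \<le> R \<and> \<bar>Im z\<bar> \<le> R \<and> (\<bar>Re z\<bar> = R \<or> \<bar>Im z\<bar> = R)"
      "norm (v - u) = 2 * R" for u v
  proof
    show i: "?g contour_integrable_on linepath u v"
      using that nz by (intro contour_integrable_continuous_linepath continuous_intros
          holomorphic_on_imp_continuous_on[OF holomorphic_on_subset[OF f]]) auto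
    show "norm (contour_integral (linepath u v) ?g) \<le> 4 * B * (2 * R)"
      using contour_integral_bound_linepath[OF i, of "4 * B"] g that \<open>0 \<le> B\<close> by auto
  qed
  have R2: "sqrt (4 * R\<^sup>2) = 2 * R"
    using \<open>R > 0\<close> by (simp add: real_sqrt_mult)
  have s1: "?g contour_integrable_on linepath a1 a2 \<and> norm (contour_integral (linepath a1 a2) ?g) \<le> 4 * B * (2 * R)"
    and s2: "?g contour_integrable_on linepath a2 a3 \<and> norm (contour_integral (linepath a2 a3) ?g) \<le> 4 * B * (2 * R)"
    and s3: "?g contour_integrable_on linepath a3 a4 \<and> norm (contour_integral (linepath a3 a4) ?g) \<le> 4 * B * (2 * R)"
    and s4: "?g contour_integrable_on linepath a4 a1 \<and> norm (contour_integral (linepath a4 a1) ?g) \<le> 4 * B * (2 * R)"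
    using \<open>R > 0\<close> R2
    by (intro side; auto simp: a1_def a2_def a3_def a4_def closed_segment_same_Re closed_segment_same_Im
        closed_segment_eq_real_ivl cmod_def)+
  have "contour_integral (rectpath a1 a3) ?g = contour_integral (linepath a1 a2) ?g +
      (contour_integral (linepath a2 a3) ?g + (contour_integral (linepath a3 a4) ?g + contour_integral (linepath a4 a1) ?g))"
    using s1 s2 s3 s4 by (simp add: rectpath_def Let_def a1_def a2_def a3_def a4_def)
  also have "norm \<dots> \<le> 4 * B * (2 * R) + (4 * B * (2 * R) + (4 * B * (2 * R) + 4 * B * (2 * R)))"
    using s1 s2 s3 s4 by (intro norm_triangle_mono) auto
  finally have "norm (contour_integral (rectpath a1 a3) ?g) \<le> 32 * B * R"
    by simp
  also have "contour_integral (rectpath a1 a3) ?g = 2 * \<i> * (\<Sum>n\<in>{- int M..int M}. (-1) powi n * f (of_int n))"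
    unfolding a1_def a3_def R_def by (rule alternating_sum_eq_contour_integral[OF f])
  finally show ?thesis
    by (simp add: norm_mult R_def algebra_simps)
qed

section \<open>Growth of cosh (c sqrt (x - (a z^2 + b z + d))) on the square\<close>

text \<open>With \<open>s = csqrt (X - a \<zeta>\<^sup>2)\<close> one has \<open>(s - \<i> sqrt a \<zeta>) * (s + \<i> sqrt a \<zeta>) = X\<close>, and the two
  factors differ by \<open>2 \<i> sqrt a \<zeta>\<close>, so the smaller one is at most \<open>\<bar>X\<bar> / (sqrt a \<bar>\<zeta>\<bar>)\<close>.\<close>
lemma abs_Re_csqrt_le:
  fixes a X :: real and \<zeta> :: complex
  assumes "a > 0" and "\<bar>X\<bar> \<le> norm \<zeta>" and "\<zeta> \<noteq> 0"
  shows "\<bar>Re (csqrt (of_real X - of_real a * \<zeta>\<^sup>2))\<bar> \<le> sqrt a * \<bar>Im \<zeta>\<bar> + 1 / sqrt a"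
proof -
  define s where "s = csqrt (of_real X - of_real a * \<zeta>\<^sup>2)"
  define q where "q = \<i> * of_real (sqrt a) * \<zeta>"
  have Req: "\<bar>Re q\<bar> = sqrt a * \<bar>Im \<zeta>\<bar>"
    using assms by (simp add: q_def abs_mult)
  have nq: "norm q = sqrt a * norm \<zeta>"
    using assms by (simp add: q_def norm_mult)
  have "q\<^sup>2 = - (of_real a * \<zeta>\<^sup>2)"
    using assms by (simp add: q_def power_mult_distrib flip: of_real_power)
  then have "(s - q) * (s + q) = of_real X"
    by (simp add: s_def algebra_simps flip: power2_eq_square)
  then have prod: "norm (s - q) * norm (s + q) = \<bar>X\<bar>"
    by (metis norm_mult norm_of_real)
  have "2 * norm q \<le> norm (s - q) + norm (s + q)"
    using norm_triangle_ineq4[of "s + q" "s - q"] by (simp add: norm_mult flip: mult_2)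
  then consider "norm q \<le> norm (s + q)" | "norm q \<le> norm (s - q)"
    by linarith
  then have "norm (s - q) \<le> 1 / sqrt a \<or> norm (s + q) \<le> 1 / sqrt a"
  proof cases
    case 1
    have "norm (s - q) * norm q \<le> norm \<zeta>"
      using mult_left_mono[OF 1 norm_ge_zero[of "s - q"]] prod assms(2) by linarith
    then show ?thesis
      using assms by (simp add: nq field_simps)
  next
    case 2
    have "norm (s + q) * norm q \<le> norm \<zeta>"
      using mult_right_mono[OF 2 norm_ge_zero[of "s + q"]] prod assms(2) by (simp add: mult.commute)
    then show ?thesis
      using assms by (simp add: nq field_simps)
  qed
  \<comment> \<open>So s lies within 1 / sqrt a of q or of -q, and both have the same absolute real
    part.\<close>
  moreover have "\<bar>Re s\<bar> \<le> \<bar>Re q\<bar> + norm (s - q)" "\<bar>Re s\<bar> \<le> \<bar>Re q\<bar> + norm (s + q)"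
    using abs_Re_le_cmod[of "s - q"] abs_Re_le_cmod[of "s + q"] by auto
  ultimately show ?thesis
    unfolding s_def[symmetric] Req by linarith
qed

lemma norm_cosh_le: "norm (cosh z) \<le> exp \<bar>Re z\<bar>" for z :: complex
proof -
  have "norm (cosh z) \<le> (exp (Re z) + exp (- Re z)) / 2"
    using norm_triangle_ineq[of "exp z" "exp (- z)"] by (simp add: cosh_field_def norm_divide)
  also have "\<dots> \<le> exp \<bar>Re z\<bar>"
    by (simp add: abs_if add_mono)
  finally show ?thesis .
qed


text \<open>Completing the square brings the radicand to the form X - a \<zeta>^2 of
  \<open>abs_Re_csqrt_le\<close>. The hypothesis on M makes \<zeta> large enough on the boundary,
  and c sqrt a <= pi keeps the growth within exp (pi |Im z|).\<close>

lemma norm_alternating_cosh_sum_le: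
  fixes a b c d x \<alpha> \<beta> :: real and k M :: nat
  assumes "a > 0" and "c > 0" and ca: "c * sqrt a \<le> pi"
    and M: "\<bar>x - d + b\<^sup>2 / (4 * a)\<bar> + \<bar>b / (2 * a)\<bar> \<le> real M"
  defines "f \<equiv> \<lambda>z::complex. cosh (c * csqrt (x - (a * z\<^sup>2 + b * z + d))) * (\<alpha> * z + \<beta>) ^ k"
  shows "norm (\<Sum>n\<in>{- int M..int M}. (-1) powi n * f (of_int n))
    \<le> 8 * (exp (c / sqrt a) * (\<bar>\<alpha>\<bar> * (2 * real M + 1) + \<bar>\<beta>\<bar>) ^ k) * (2 * real M + 1)"
proof (rule norm_alternating_sum_le)
  have "(\<lambda>z. cosh (c * csqrt (x - (a * z\<^sup>2 + b * z + d)))) holomorphic_on (UNIV :: complex set)"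
    by (rule holomorphic_on_compose_gen[OF _ holomorphic_cosh_csqrt, unfolded o_def])
      (intro holomorphic_intros, simp)
  then show "f holomorphic_on UNIV"
    unfolding f_def by (intro holomorphic_intros)
next
  fix z :: complex
  assume z: "\<bar>Re z\<bar> \<le> real M + 1/2" "\<bar>Im z\<bar> \<le> real M + 1/2" "\<bar>Re z\<bar> = real M + 1/2 \<or> \<bar>Im z\<bar> = real M + 1/2"
  define X \<zeta> where "X = x - d + b\<^sup>2 / (4 * a)" and "\<zeta> = z + of_real (b / (2 * a))"
  define s where "s = csqrt (of_real X - of_real a * \<zeta>\<^sup>2)"
  have "of_real X - of_real a * \<zeta>\<^sup>2 = x - (a * z\<^sup>2 + b * z + d)"
    using \<open>a > 0\<close> by (simp add: X_def \<zeta>_def field_simps power2_eq_square)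
  then have f_eq: "f z = cosh (of_real c * s) * (\<alpha> * z + \<beta>) ^ k"
    by (simp add: f_def s_def)
  \<comment> \<open>A boundary point has norm at least M + 1/2; the extra 1/2 ensures that \<zeta>
    is nonzero.\<close>
  have "real M + 1/2 \<le> norm z"
    using z(3) abs_Re_le_cmod[of z] abs_Im_le_cmod[of z] by auto
  also have "norm z \<le> norm \<zeta> + \<bar>b / (2 * a)\<bar>"
    using norm_triangle_ineq4[of \<zeta> "of_real (b / (2 * a))"] by (simp add: \<zeta>_def flip: of_real_divide)
  finally have zeta: "\<bar>X\<bar> + 1/2 \<le> norm \<zeta>"
    using M by (simp add: X_def)
  then have "\<bar>X\<bar> \<le> norm \<zeta>" "\<zeta> \<noteq> 0"
    by auto
  then have "c * \<bar>Re s\<bar> \<le> c * (sqrt a * \<bar>Im \<zeta>\<bar> + 1 / sqrt a)"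
    unfolding s_def using assms by (intro mult_left_mono abs_Re_csqrt_le) auto
  also have "\<dots> \<le> pi * \<bar>Im z\<bar> + c / sqrt a"
    using mult_right_mono[OF ca, of "\<bar>Im z\<bar>"] by (simp add: \<zeta>_def algebra_simps)
  finally have "exp \<bar>Re (of_real c * s)\<bar> \<le> exp (c / sqrt a) * exp (pi * \<bar>Im z\<bar>)"
    using \<open>c > 0\<close> by (simp add: abs_mult add.commute flip: exp_add)
  then have 1: "norm (cosh (of_real c * s)) \<le> exp (c / sqrt a) * exp (pi * \<bar>Im z\<bar>)"
    using norm_cosh_le order_trans by blast
  have "norm z \<le> 2 * real M + 1"
    using cmod_le[of z] z by linarith
  then have "norm (\<alpha> * z + \<beta>) \<le> \<bar>\<alpha>\<bar> * (2 * real M + 1) + \<bar>\<beta>\<bar>"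
    by (intro norm_triangle_mono) (auto simp: norm_mult mult_left_mono)
  then have "norm ((\<alpha> * z + \<beta>) ^ k) \<le> (\<bar>\<alpha>\<bar> * (2 * real M + 1) + \<bar>\<beta>\<bar>) ^ k"
    by (simp add: norm_power power_mono)
  from mult_mono[OF 1 this]
  show "norm (f z) \<le> exp (c / sqrt a) * (\<bar>\<alpha>\<bar> * (2 * real M + 1) + \<bar>\<beta>\<bar>) ^ k * exp (pi * \<bar>Im z\<bar>)"
    by (simp add: f_eq norm_mult mult_ac)
qed

section \<open>Polynomial bounds for the alternating exponential sums\<close>

text \<open>Each term is replaced by \<open>2 * cosh\<close>, and the sum is extended to all \<open>n\<close> up to \<open>M\<close>: this costs
  \<open>exp (- c * sqrt \<dots>)\<close> inside the range of summation and \<open>2 * cos (c * sqrt \<dots>)\<close> outside of it.\<close>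
lemma abs_alternating_exp_sum_le:
  fixes a b c d x \<alpha> \<beta> :: real and k M :: nat
  assumes "a > 0" and "c > 0" and ca: "c * sqrt a \<le> pi"
    and M: "\<bar>x - d + b\<^sup>2 / (4 * a)\<bar> + \<bar>b / (2 * a)\<bar> \<le> real M"
  defines "I \<equiv> {n::int. a * (real_of_int n)\<^sup>2 + b * real_of_int n + d < x}"
  assumes I: "I \<subseteq> {- int M..int M}"
  shows "\<bar>\<Sum>n\<in>I. (-1) powi n * exp (c * sqrt (x - (a * (real_of_int n)\<^sup>2 + b * real_of_int n + d)))
            * (\<alpha> * real_of_int n + \<beta>) ^ k\<bar>
    \<le> (16 * exp (c / sqrt a) + 2) * (2 * real M + 1) * (\<bar>\<alpha>\<bar> * (2 * real M + 1) + \<bar>\<beta>\<bar>) ^ k"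
proof -
  define Q where "Q = (\<lambda>n. a * (real_of_int n)\<^sup>2 + b * real_of_int n + d)"
  define h where "h = (\<lambda>n. (\<alpha> * real_of_int n + \<beta>) ^ k)"
  define f where "f = (\<lambda>z::complex. cosh (c * csqrt (x - (a * z\<^sup>2 + b * z + d))) * (\<alpha> * z + \<beta>) ^ k)"
  define T where "T = (\<lambda>n. if n \<in> I then exp (c * sqrt (x - Q n)) * h n else 0)"
  define H where "H = (\<bar>\<alpha>\<bar> * (2 * real M + 1) + \<bar>\<beta>\<bar>) ^ k"
  define J where "J = {- int M..int M}"
  have f_eq: "f (of_int n) = cosh (c * csqrt (of_real (x - Q n))) * of_real (h n)" for n
    by (simp add: f_def Q_def h_def)
  have h_le: "\<bar>h n\<bar> \<le> H" if "n \<in> J" for n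
  proof -
    have "\<bar>real_of_int n\<bar> \<le> 2 * real M + 1"
      using that by (auto simp: J_def)
    then have "\<bar>\<alpha> * real_of_int n + \<beta>\<bar> \<le> \<bar>\<alpha>\<bar> * (2 * real M + 1) + \<bar>\<beta>\<bar>"
      by (intro order_trans[OF abs_triangle_ineq] add_mono) (auto simp: abs_mult mult_left_mono)
    then show ?thesis
      by (simp add: h_def H_def power_abs power_mono)
  qed
  have diff: "norm ((-1) powi n * (of_real (T n) - 2 * f (of_int n))) \<le> 2 * H" if "n \<in> J" for n
  proof (cases "n \<in> I")
    case True
    define s where "s = c * sqrt (x - Q n)"
    have "s \<ge> 0"
      using True \<open>c > 0\<close> by (simp add: s_def I_def Q_def)
    have "f (of_int n) = of_real (cosh s * h n)"
    proof -
      have "csqrt (of_real (x - Q n)) = of_real (sqrt (x - Q n))"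
        using True by (intro of_real_sqrt[symmetric]) (simp add: I_def Q_def)
      then have "c * csqrt (of_real (x - Q n)) = complex_of_real s"
        by (simp only: s_def of_real_mult)
      moreover have "cosh (complex_of_real s) = of_real (cosh s)"
        by (simp add: cosh_field_def flip: exp_of_real)
      ultimately show ?thesis
        by (simp only: f_eq of_real_mult)
    qed
    have "exp s - 2 * cosh s = - exp (- s)"
      by (simp add: cosh_field_def field_simps)
    have f_diff: "of_real (T n) - 2 * f (of_int n) = of_real (- (exp (- s)) * h n)"
    proof -
      have "T n = exp s * h n"
        using True by (simp add: T_def s_def)
      then have "T n - 2 * (cosh s * h n) = (exp s - 2 * cosh s) * h n"
        by (simp add: algebra_simps)
      also note \<open>exp s - 2 * cosh s = - exp (- s)\<close>
      finally show ?thesis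
        unfolding \<open>f (of_int n) = of_real (cosh s * h n)\<close>
        by (metis of_real_diff of_real_mult of_real_numeral)
    qed
    have "\<bar>exp (- s) * h n\<bar> \<le> 1 * H"
      unfolding abs_mult using h_le[OF that] \<open>s \<ge> 0\<close> by (intro mult_mono) auto
    then show ?thesis
      unfolding f_diff using h_le[OF that] by (simp add: norm_mult norm_power_int abs_mult)
  next
    case False
    \<comment> \<open>Outside the range of summation the radicand is nonpositive, so its root is
      purely imaginary.\<close>
    then have Re_0: "Re (c * csqrt (of_real (x - Q n))) = 0"
      by (simp add: I_def Q_def del: of_real_diff)
    then have "norm (cosh (c * csqrt (of_real (x - Q n)))) \<le> 1"
      using norm_cosh_le[of "c * csqrt (of_real (x - Q n))", unfolded Re_0] by (simp only: abs_zero exp_zero)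
    then have "norm (f (of_int n)) \<le> 1 * H"
      unfolding f_eq norm_mult using h_le[OF that] by (intro mult_mono) auto
    then show ?thesis
      using False by (simp add: norm_mult norm_power_int T_def)
  qed
  have "(\<Sum>n\<in>I. (-1) powi n * exp (c * sqrt (x - Q n)) * h n) = (\<Sum>n\<in>J. (-1) powi n * T n)"
    using I by (intro sum.mono_neutral_cong_left) (auto simp: T_def J_def)
  then have "complex_of_real (\<Sum>n\<in>I. (-1) powi n * exp (c * sqrt (x - Q n)) * h n)
      = (\<Sum>n\<in>J. (-1) powi n * of_real (T n))"
    by (simp add: of_real_power_int)
  also have "\<dots> = 2 * (\<Sum>n\<in>J. (-1) powi n * f (of_int n)) + (\<Sum>n\<in>J. (-1) powi n * (of_real (T n) - 2 * f (of_int n)))"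
    by (simp add: sum_distrib_left sum_subtractf algebra_simps flip: sum.distrib)
  also have "norm \<dots> \<le> 2 * (8 * (exp (c / sqrt a) * H) * (2 * real M + 1)) + of_nat (card J) * (2 * H)"
  proof (rule norm_triangle_mono)
    have "norm (\<Sum>n\<in>J. (-1) powi n * f (of_int n)) \<le> 8 * (exp (c / sqrt a) * H) * (2 * real M + 1)"
      unfolding f_def J_def H_def by (rule norm_alternating_cosh_sum_le[OF assms(1-4)])
    from mult_left_mono[OF this, of 2] show "norm (2 * (\<Sum>n\<in>J. (-1) powi n * f (of_int n))) \<le> 2 * (8 * (exp (c / sqrt a) * H) * (2 * real M + 1))"
      unfolding norm_mult by simp
    show "norm (\<Sum>n\<in>J. (-1) powi n * (of_real (T n) - 2 * f (of_int n))) \<le> of_nat (card J) * (2 * H)"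
      using diff by (rule sum_norm_bound)
  qed
  also have "real (card J) = 2 * real M + 1"
    by (simp add: J_def)
  finally show ?thesis
    unfolding norm_of_real Q_def h_def H_def by (simp add: algebra_simps)
qed

text \<open>The cutoff M can be chosen of order x. The factor 2 M + 1 then contributes one power of
  x, and the weight contributes k more.\<close>

lemma alternating_exp_sum_polynomial_bound:
  fixes a b c d \<alpha> \<beta> :: real and k :: nat
  assumes "a > 0" and "c > 0" and "c * sqrt a \<le> pi"
  shows "\<exists>C. \<forall>x\<ge>1. \<bar>\<Sum>n\<in>{n::int. a * (real_of_int n)\<^sup>2 + b * real_of_int n + d < x}.
      (-1) powi n * exp (c * sqrt (x - (a * (real_of_int n)\<^sup>2 + b * real_of_int n + d)))
        * (\<alpha> * real_of_int n + \<beta>) ^ k\<bar> \<le> C * x ^ Suc k"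
proof -
  define \<rho> where "\<rho> = b / (2 * a)"
  \<comment> \<open>L and K are chosen so that |X| <= L x and 2 M + 1 <= K x for all x >= 1.\<close>
  define L where "L = 1 + \<bar>d\<bar> + b\<^sup>2 / (4 * a)"
  define K where "K = 2 * (L + L / a + \<bar>\<rho>\<bar> + 2) + 1"
  define C where "C = (16 * exp (c / sqrt a) + 2) * K * ((\<bar>\<alpha>\<bar> + \<bar>\<beta>\<bar>) * K) ^ k"
  have "\<bar>\<Sum>n\<in>{n::int. a * (real_of_int n)\<^sup>2 + b * real_of_int n + d < x}.
      (-1) powi n * exp (c * sqrt (x - (a * (real_of_int n)\<^sup>2 + b * real_of_int n + d)))
        * (\<alpha> * real_of_int n + \<beta>) ^ k\<bar> \<le> C * x ^ Suc k" if "x \<ge> 1" for x :: real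
  proof -
    define X where "X = x - d + b\<^sup>2 / (4 * a)"
    define V where "V = \<bar>X\<bar> / a"
    \<comment> \<open>The summand |X| serves the contour bound. The rest puts the range of summation
      inside [-M, M]: there u^2 <= V, hence |u| <= 1 + V, and u differs from n by \<rho>.\<close>
    define M where "M = nat \<lceil>\<bar>X\<bar> + V + 1 + \<bar>\<rho>\<bar>\<rceil>"
    define I where "I = {n::int. a * (real_of_int n)\<^sup>2 + b * real_of_int n + d < x}"
    have M_ge: "\<bar>X\<bar> + V + 1 + \<bar>\<rho>\<bar> \<le> real M"
      unfolding M_def by linarith
    have "0 \<le> V"
      using \<open>a > 0\<close> by (simp add: V_def)
    then have M_le: "real M \<le> \<bar>X\<bar> + V + 2 + \<bar>\<rho>\<bar>"
      unfolding M_def by linarith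
    have M1: "\<bar>x - d + b\<^sup>2 / (4 * a)\<bar> + \<bar>b / (2 * a)\<bar> \<le> real M"
      using M_ge \<open>0 \<le> V\<close> by (simp add: \<rho>_def X_def)
    have I_sub: "I \<subseteq> {- int M..int M}"
    proof
      fix n
      assume "n \<in> I"
      define u where "u = real_of_int n + \<rho>"
      have "a * (real_of_int n)\<^sup>2 + b * real_of_int n + d = a * u\<^sup>2 + x - X"
        using \<open>a > 0\<close> by (simp add: u_def \<rho>_def X_def field_simps power2_eq_square)
      with \<open>n \<in> I\<close> have "a * u\<^sup>2 \<le> \<bar>X\<bar>"
        by (simp add: I_def)
      then have "u\<^sup>2 \<le> V"
        using \<open>a > 0\<close> by (simp add: V_def field_simps)
      moreover have "\<bar>u\<bar> \<le> 1 + u\<^sup>2"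
      proof (cases "\<bar>u\<bar> \<le> 1")
        case True
        then show ?thesis
          by (simp add: add_increasing2)
      next
        case False
        then have "\<bar>u\<bar> ^ 1 \<le> \<bar>u\<bar> ^ 2"
          by (intro power_increasing) auto
        then show ?thesis
          by simp
      qed
      ultimately have "\<bar>real_of_int n\<bar> \<le> real M"
        using M_ge by (simp add: u_def)
      then show "n \<in> {- int M..int M}"
        by auto
    qed
    have X_le: "\<bar>X\<bar> \<le> L * x"
    proof -
      have "\<bar>X\<bar> \<le> \<bar>x\<bar> + \<bar>d\<bar> + \<bar>b\<^sup>2 / (4 * a)\<bar>"
        unfolding X_def by (rule order_trans[OF abs_triangle_ineq add_mono[OF abs_triangle_ineq4 order_refl]])
      then have "\<bar>X\<bar> \<le> x + (\<bar>d\<bar> + b\<^sup>2 / (4 * a)) * 1"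
        using \<open>a > 0\<close> \<open>x \<ge> 1\<close> by simp
      also have "\<dots> \<le> x + (\<bar>d\<bar> + b\<^sup>2 / (4 * a)) * x"
        using \<open>a > 0\<close> \<open>x \<ge> 1\<close> by (intro add_left_mono mult_left_mono) auto
      finally show ?thesis
        by (simp add: L_def algebra_simps)
    qed
    then have "V \<le> L * x / a"
      using \<open>a > 0\<close> by (simp add: V_def divide_right_mono)
    moreover have "(2 * \<bar>\<rho>\<bar> + 5) * 1 \<le> (2 * \<bar>\<rho>\<bar> + 5) * x"
      using \<open>x \<ge> 1\<close> by (intro mult_left_mono) auto
    moreover have "2 * real M + 1 \<le> 2 * \<bar>X\<bar> + 2 * V + (2 * \<bar>\<rho>\<bar> + 5) * 1"
      using M_le by simp
    ultimately have "2 * real M + 1 \<le> 2 * (L * x) + 2 * (L * x / a) + (2 * \<bar>\<rho>\<bar> + 5) * x"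
      using X_le \<open>x \<ge> 1\<close> by (elim order_trans) (intro add_mono mult_left_mono; simp)
    also have "\<dots> = K * x"
      by (simp add: K_def algebra_simps)
    finally have MK: "2 * real M + 1 \<le> K * x" .
    have "K * x \<ge> 0"
      using MK by linarith
    have "1 \<le> 2 * real M + 1"
      by simp
    then have "\<bar>\<alpha>\<bar> * (2 * real M + 1) + \<bar>\<beta>\<bar> \<le> \<bar>\<alpha>\<bar> * (K * x) + \<bar>\<beta>\<bar> * (K * x)"
      using MK mult_left_mono[of 1 "K * x" "\<bar>\<beta>\<bar>"] by (intro add_mono mult_left_mono) auto
    then have "(\<bar>\<alpha>\<bar> * (2 * real M + 1) + \<bar>\<beta>\<bar>) ^ k \<le> ((\<bar>\<alpha>\<bar> + \<bar>\<beta>\<bar>) * (K * x)) ^ k"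
      by (intro power_mono) (auto simp: algebra_simps)
    then have "(16 * exp (c / sqrt a) + 2) * (2 * real M + 1) * (\<bar>\<alpha>\<bar> * (2 * real M + 1) + \<bar>\<beta>\<bar>) ^ k
        \<le> (16 * exp (c / sqrt a) + 2) * (K * x) * ((\<bar>\<alpha>\<bar> + \<bar>\<beta>\<bar>) * (K * x)) ^ k"
      using MK \<open>K * x \<ge> 0\<close> by (intro mult_mono) auto
    with abs_alternating_exp_sum_le[OF assms M1 I_sub[unfolded I_def], of \<alpha> \<beta> k]
    show ?thesis
      by (simp add: C_def power_mult_distrib mult_ac)
  qed
  then show ?thesis
    by blast
qed

section \<open>Consequences of the existence of a maximum of Delta\<close>

text \<open>With y = sqrt a r, the factor (sqrt (y^2 + 4) + y) / 2 is at least y and at least 1. The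
  first bound is used for large r, the second for small r.\<close>

lemma Delta_ge:
  assumes "a > 0" and "r \<ge> 0"
  shows "sqrt a * r - pi * r / c \<le> Delta a c r" and "sqrt (sqrt a * r) - pi * r / c \<le> Delta a c r"
proof -
  define y where "y = sqrt a * r"
  have "y \<ge> 0"
    using assms by (simp add: y_def)
  define g where "g = (sqrt (a * r\<^sup>2 + 4) + r * sqrt a) / 2"
  have "a * r\<^sup>2 + 4 = y\<^sup>2 + 4"
    using assms by (simp add: y_def power_mult_distrib)
  moreover have "y \<le> sqrt (y\<^sup>2 + 4)" "2 \<le> sqrt (y\<^sup>2 + 4)"
    using \<open>y \<ge> 0\<close> by (auto intro: real_le_rsqrt)
  ultimately have g: "y \<le> g" "1 \<le> g"
    using \<open>y \<ge> 0\<close> by (auto simp: g_def y_def mult.commute)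
  have D: "Delta a c r = sqrt (y * g) - pi * r / c"
    by (simp add: Delta_def y_def g_def)
  have "y * y \<le> y * g" "y * 1 \<le> y * g"
    using g \<open>y \<ge> 0\<close> by (intro mult_left_mono; simp)+
  then have "y \<le> sqrt (y * g)" "sqrt y \<le> sqrt (y * g)"
    by (auto intro!: real_le_rsqrt simp: power2_eq_square)
  then show "sqrt a * r - pi * r / c \<le> Delta a c r" "sqrt (sqrt a * r) - pi * r / c \<le> Delta a c r"
    unfolding D y_def by auto
qed

text \<open>If c sqrt a > pi, the linear lower bound for Delta has positive slope sqrt a - pi / c,
  so Delta is unbounded.\<close>

lemma Delta_maximum_imp_le_pi:
  assumes "a > 0" and "c > 0" and max: "\<forall>r\<ge>0. Delta a c r \<le> D"
  shows "c * sqrt a \<le> pi"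
proof (rule ccontr)
  assume "\<not> ?thesis"
  then have e: "sqrt a - pi / c > 0"
    using \<open>c > 0\<close> by (simp add: field_simps)
  \<comment> \<open>Here the linear lower bound takes the value |D| + 1.\<close>
  define r where "r = (\<bar>D\<bar> + 1) / (sqrt a - pi / c)"
  have "r \<ge> 0"
    using e by (simp add: r_def)
  have "\<bar>D\<bar> + 1 = (sqrt a - pi / c) * r"
    using e by (simp add: r_def)
  also have "\<dots> = sqrt a * r - pi * r / c"
    by (simp add: left_diff_distrib)
  also have "\<dots> \<le> D"
    using Delta_ge(1)[OF \<open>a > 0\<close> \<open>r \<ge> 0\<close>] max \<open>r \<ge> 0\<close> by (meson order_trans)
  finally show False
    by simp
qed

lemma Delta_maximum_pos:
  assumes "a > 0" and "c > 0" and max: "\<forall>r\<ge>0. Delta a c r \<le> D"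
  shows "0 < D"
proof -
  \<comment> \<open>This r maximizes the lower bound sqrt (sqrt a r) - pi r / c: in terms of s =
    sqrt (sqrt a r) it is a quadratic, whose maximum value is s / 2 at this s.\<close>
  define r s where "r = sqrt a * (c / (2 * pi))\<^sup>2" and "s = sqrt a * c / (2 * pi)"
  have "s > 0"
    using assms by (simp add: s_def)
  have "r \<ge> 0"
    using \<open>a > 0\<close> by (simp add: r_def)
  have "sqrt a * r = s\<^sup>2"
    by (simp add: r_def s_def power2_eq_square)
  then have "sqrt (sqrt a * r) = s"
    using \<open>s > 0\<close> by simp
  moreover have "pi * r / c = s / 2"
    using \<open>c > 0\<close> by (simp add: r_def s_def power2_eq_square field_simps)
  ultimately have "0 < sqrt (sqrt a * r) - pi * r / c"
    using \<open>s > 0\<close> by simp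
  also have "\<dots> \<le> D"
    using Delta_ge(2)[OF \<open>a > 0\<close> \<open>r \<ge> 0\<close>] max \<open>r \<ge> 0\<close> by (meson order_trans)
  finally show ?thesis .
qed

section \<open>The weight h and the final comparison of growth\<close>

text \<open>A nonconstant affine function takes the values -1 and 0: the former forces t to be an
  integer, the latter forces t >= 0. If \<alpha> = 0, the constant value is written as an affine
  function of slope 0 with exponent 1.\<close>

lemma real_power_affine_eq_power:
  assumes defined: "\<forall>y::real. real_power_defined (\<alpha> * y + \<beta>) t"
  shows "\<exists>\<alpha>' \<beta>' k. \<forall>y. real_power (\<alpha> * y + \<beta>) t = (\<alpha>' * y + \<beta>') ^ k"
proof (cases "\<alpha> = 0")
  case True
  then have "\<forall>y. real_power (\<alpha> * y + \<beta>) t = (0 * y + real_power \<beta> t) ^ 1"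
    by simp
  then show ?thesis
    by blast
next
  case False
  have "real_power_defined (-1) t" "real_power_defined 0 t"
    using defined[rule_format, of "(-1 - \<beta>) / \<alpha>"] defined[rule_format, of "- \<beta> / \<alpha>"] False by auto
  then have "t \<in> \<int>" "t \<ge> 0"
    by (auto simp: real_power_defined_def)
  then have "\<forall>y. real_power (\<alpha> * y + \<beta>) t = (\<alpha> * y + \<beta>) ^ nat \<lfloor>t\<rfloor>"
    by (simp add: real_power_def power_int_def)
  then show ?thesis
    by blast
qed

lemma power_in_bigo_exp_sqrt:
  assumes "e > 0"
  shows "(\<lambda>x::real. x ^ k) \<in> O(\<lambda>x. sqrt x * exp (e * sqrt x))"
proof -
  have "(\<lambda>x::real. x powr real k) \<in> O(\<lambda>x. sqrt x * exp (e * sqrt x))"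
    using assms by real_asymp
  moreover have "\<forall>\<^sub>F x::real in at_top. x powr real k = x ^ k"
    using eventually_gt_at_top[of 0] by eventually_elim (simp add: powr_realpow)
  ultimately show ?thesis
    by (subst (asm) landau_o.big.in_cong)
qed

theorem theorem1:
  fixes a b c d \<alpha> \<beta> t r0 w :: real and h :: "real \<Rightarrow> real"
  assumes "a > 0" and "c > 0"
    and h_defined: "\<forall>y::real. real_power_defined (\<alpha> * y + \<beta>) t"
    and h_def: "\<forall>y::real. h y = real_power (\<alpha> * y + \<beta>) t"
    and "r0 \<ge> 0" and r0_max: "\<forall>r\<ge>0. Delta a c r \<le> Delta a c r0"
    and w_def: "w = min 1 (Delta a c r0)"
  shows "(\<lambda>x::real. \<Sum>n\<in>{n::int. a * (real_of_int n)\<^sup>2 + b * real_of_int n + d < x}.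
             (-1) powi n
               * exp (c * sqrt (x - (a * (real_of_int n)\<^sup>2 + b * real_of_int n + d)))
               * h (real_of_int n))
         \<in> O[at_top](\<lambda>x. sqrt x * exp (w * c * sqrt x))"
proof -
  have ca: "c * sqrt a \<le> pi"
    by (rule Delta_maximum_imp_le_pi[OF \<open>a > 0\<close> \<open>c > 0\<close> r0_max])
  \<comment> \<open>Positivity of the exponent is all that is needed of w, since the sum is bounded
    by a power of x.\<close>
  have "w * c > 0"
    using Delta_maximum_pos[OF \<open>a > 0\<close> \<open>c > 0\<close> r0_max] \<open>c > 0\<close> by (simp add: w_def)
  obtain \<alpha>' \<beta>' k where h: "\<And>y. h y = (\<alpha>' * y + \<beta>') ^ k"
    using real_power_affine_eq_power[OF h_defined] h_def by auto
  obtain C where C: "\<And>x. x \<ge> 1 \<Longrightarrow>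
      \<bar>\<Sum>n\<in>{n::int. a * (real_of_int n)\<^sup>2 + b * real_of_int n + d < x}. (-1) powi n
        * exp (c * sqrt (x - (a * (real_of_int n)\<^sup>2 + b * real_of_int n + d))) * h (real_of_int n)\<bar>
      \<le> C * x ^ Suc k"
    using alternating_exp_sum_polynomial_bound[OF \<open>a > 0\<close> \<open>c > 0\<close> ca, of b d \<alpha>' \<beta>' k] unfolding h by blast
  have "(\<lambda>x::real. \<Sum>n\<in>{n::int. a * (real_of_int n)\<^sup>2 + b * real_of_int n + d < x}. (-1) powi n
        * exp (c * sqrt (x - (a * (real_of_int n)\<^sup>2 + b * real_of_int n + d))) * h (real_of_int n))
      \<in> O(\<lambda>x. x ^ Suc k)"
    by (intro bigoI[of _ C] eventually_mono[OF eventually_ge_at_top[of 1]]) (use C in auto)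
  also have "(\<lambda>x::real. x ^ Suc k) \<in> O(\<lambda>x. sqrt x * exp (w * c * sqrt x))"
    by (rule power_in_bigo_exp_sqrt[OF \<open>w * c > 0\<close>])
  finally show ?thesis .
qed

end
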